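(* Let $X$ be an infinite zero-dimensional compact Hausdorff space. Then its function space $C_k(X,X)$ is not an $F$-space.
   Context: Zero-dimensional means having a base of clopen sets. $C_k(X,X)$ denotes the set of continuous functions $X\to X$ with the compact-open topology, generated by the subbasis of sets $[C,U]=\{f : f(C)\subseteq U\}$ with $C\subseteq X$ compact and $U\subseteq X$ open. A cozero-set in a Tychonoff space $Z$ is the complement of a set of the form $g^{-1}(0)$ with $g\colon Z\to\mathbb{R}$ continuous. A subspace $Y\subseteq Z$ is $C^*$-embedded if every bounded continuous real-valued function on $Y$ extends to a continuous function on $Z$. An $F$-space is a Tychonoff space in which each cozero-set is $C^*$-embedded. *)

theory Defs
  imports "HOL-Analysis.Analysis"
begin

definition zero_dimensional_space :: "'a topology \<Rightarrow> bool" where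
  "zero_dimensional_space X \<longleftrightarrow>
     (\<exists>\<B>. (\<forall>B\<in>\<B>. openin X B \<and> closedin X B) \<and>
          openin X = arbitrary union_of (\<lambda>B. B \<in> \<B>))"

text \<open>A continuous function from \<open>X\<close> to \<open>Y\<close> is represented by its unique representative
  that is \<open>undefined\<close> outside \<open>topspace X\<close>, so that two functions agreeing on
  \<open>topspace X\<close> are the same point of the function space (as in \<^const>\<open>product_topology\<close>).\<close>

definition continuous_functions :: "'a topology \<Rightarrow> 'b topology \<Rightarrow> ('a \<Rightarrow> 'b) set" where
  "continuous_functions X Y = {f \<in> extensional (topspace X). continuous_map X Y f}"

definition compact_open_topology :: "'a topology \<Rightarrow> 'b topology \<Rightarrow> ('a \<Rightarrow> 'b) topology" where
  "compact_open_topology X Y =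
     topology_generated_by
       {{f \<in> continuous_functions X Y. f ` C \<subseteq> U} | C U. compactin X C \<and> openin Y U}"

text \<open>The library's generated topology has the union of the subbasis as its underlying set;
  here that is the whole function space, because \<open>C = {}\<close> is allowed.\<close>

lemma topspace_compact_open_topology [simp]:
  "topspace (compact_open_topology X Y) = continuous_functions X Y"
proof -
  have "continuous_functions X Y \<in>
      {{f \<in> continuous_functions X Y. f ` C \<subseteq> U} | C U. compactin X C \<and> openin Y U}"
    by (force intro: exI[of _ "{}"])
  then show ?thesis
    unfolding compact_open_topology_def topology_generated_by_topspace by blast
qed

definition Tychonoff_space :: "'a topology \<Rightarrow> bool" where
  "Tychonoff_space Z \<longleftrightarrow> completely_regular_space Z \<and> Hausdorff_space Z"

definition cozero_set :: "'a topology \<Rightarrow> 'a set \<Rightarrow> bool" where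
  "cozero_set Z S \<longleftrightarrow>
     (\<exists>g. continuous_map Z euclideanreal g \<and> S = topspace Z - {x \<in> topspace Z. g x = 0})"

definition Cstar_embedded :: "'a topology \<Rightarrow> 'a set \<Rightarrow> bool" where
  "Cstar_embedded Z Y \<longleftrightarrow> Y \<subseteq> topspace Z \<and>
     (\<forall>f. continuous_map (subtopology Z Y) euclideanreal f \<and> bounded (f ` Y) \<longrightarrow>
        (\<exists>g. continuous_map Z euclideanreal g \<and> (\<forall>y\<in>Y. g y = f y)))"

definition F_space :: "'a topology \<Rightarrow> bool" where
  "F_space Z \<longleftrightarrow> Tychonoff_space Z \<and> (\<forall>S. cozero_set Z S \<longrightarrow> Cstar_embedded Z S)"

end

theory Submission
  imports Defs
begin

text \<open>
  The argument has two halves, joined by a retraction.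

  A product \<open>X \<times> X\<close> of a space with itself is rarely an F-space. Given a continuous
  \<open>h: X \<rightarrow> \<real>\<close> with \<open>h \<ge> 0\<close>, the function \<open>sgn (h y - h x)\<close> is bounded and continuous on the
  cozero-set where \<open>h x \<noteq> h y\<close>. If \<open>p\<close> is a zero of \<open>h\<close> that is a limit of points \<open>x\<close> with
  \<open>h x > 0\<close>, then a continuous extension \<open>g\<close> would take the value \<open>1\<close> at all \<open>(p, x)\<close> and \<open>-1\<close>
  at all \<open>(x, p)\<close>, and both families converge to the single point \<open>(p, p)\<close>. Hence if all
  cozero-sets of \<open>X \<times> X\<close> are \<open>C\<^sup>*\<close>-embedded, all zero-sets of \<open>X\<close> are open
  (\<open>square_Cstar_embedded_imp_zero_sets_open\<close>). An infinite compact zero-dimensional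
  Hausdorff space has a zero-set that is not open, namely the intersection of a strictly
  decreasing sequence of clopen sets (\<open>exists_zero_set_not_open\<close>).

  On the other hand \<open>X \<times> X\<close> is a retract of \<open>C\<^sub>k(X,X)\<close>: split \<open>X\<close> into two nonempty clopen
  pieces with points \<open>a\<close> and \<open>b\<close> in them. A pair \<open>(x, y)\<close> goes to the function with the
  constant values \<open>x\<close> and \<open>y\<close> on the two pieces, and evaluation at \<open>a\<close> and \<open>b\<close> is a continuous left
  inverse (\<open>square_retract_of_function_space\<close>). The \<open>C\<^sup>*\<close>-embedding of all cozero-sets passes
  to retracts (\<open>Cstar_embedded_cozero_retraction\<close>), so \<open>C\<^sub>k(X,X)\<close> cannot be an F-space.
\<close>

section \<open>Retracts and squares\<close>

text \<open>A cozero-set and a function on it are pulled back along the retraction; an extension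
  found upstairs is restricted along the section.\<close>

lemma Cstar_embedded_cozero_retraction:
  assumes ret: "retraction_maps Z Y r s"
    and Z: "\<And>S. cozero_set Z S \<Longrightarrow> Cstar_embedded Z S"
    and S: "cozero_set Y S"
  shows "Cstar_embedded Y S"
proof -
  have r: "continuous_map Z Y r" and s: "continuous_map Y Z s"
    and rs: "\<And>y. y \<in> topspace Y \<Longrightarrow> r (s y) = y"
    using ret by (auto simp: retraction_maps_def)
  obtain u where u: "continuous_map Y euclideanreal u"
    and Seq: "S = topspace Y - {y \<in> topspace Y. u y = 0}"
    using S by (auto simp: cozero_set_def)
  define T where "T = {z \<in> topspace Z. r z \<in> S}"
  have rZ: "\<And>z. z \<in> topspace Z \<Longrightarrow> r z \<in> topspace Y" and sY: "\<And>y. y \<in> topspace Y \<Longrightarrow> s y \<in> topspace Z"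
    using r s by (auto simp: continuous_map_def)
  have "cozero_set Z T"
    unfolding cozero_set_def
    by (rule exI[of _ "u \<circ> r"])
      (use continuous_map_compose[OF r u] rZ in \<open>auto simp: T_def Seq\<close>)
  then have T: "Cstar_embedded Z T" by (rule Z)
  have rT: "continuous_map (subtopology Z T) (subtopology Y S) r"
    using r by (auto simp: continuous_map_in_subtopology continuous_map_from_subtopology T_def)
  show ?thesis
    unfolding Cstar_embedded_def
  proof (intro conjI allI impI)
    show "S \<subseteq> topspace Y" by (auto simp: Seq)
    fix f assume f: "continuous_map (subtopology Y S) euclideanreal f \<and> bounded (f ` S)"
    have "continuous_map (subtopology Z T) euclideanreal (f \<circ> r)"
      using continuous_map_compose[OF rT] f by blast
    moreover have "bounded ((f \<circ> r) ` T)"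
      by (rule bounded_subset[of "f ` S"]) (use f in \<open>auto simp: T_def\<close>)
    ultimately obtain g where g: "continuous_map Z euclideanreal g" "\<forall>z\<in>T. g z = (f \<circ> r) z"
      using T unfolding Cstar_embedded_def by blast
    have "\<forall>y\<in>S. (g \<circ> s) y = f y"
      using g(2) rs sY by (auto simp: T_def Seq)
    then show "\<exists>g. continuous_map Y euclideanreal g \<and> (\<forall>y\<in>S. g y = f y)"
      using continuous_map_compose[OF s g(1)] by blast
  qed
qed

text \<open>If \<open>p\<close> is a boundary point of the zero-set of \<open>h\<close>, then \<open>(p, p)\<close> is a limit both of points \<open>(p, x)\<close>
  where the sign of \<open>\<bar>h v\<bar> - \<bar>h u\<bar>\<close> at \<open>(u, v)\<close> is \<open>1\<close> and of points \<open>(x, p)\<close> where it is \<open>-1\<close>.\<close>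

lemma square_Cstar_embedded_imp_zero_sets_open:
  fixes h :: "'a \<Rightarrow> real"
  assumes XX: "\<And>S. cozero_set (prod_topology X X) S \<Longrightarrow> Cstar_embedded (prod_topology X X) S"
    and h: "continuous_map X euclideanreal h"
  shows "openin X {x \<in> topspace X. h x = 0}"
proof -
  let ?XX = "prod_topology X X"
  define N where "N = {x \<in> topspace X. h x \<noteq> 0}"
  define d where "d z = \<bar>h (snd z)\<bar> - \<bar>h (fst z)\<bar>" for z
  define S where "S = topspace ?XX - {z \<in> topspace ?XX. d z = 0}"
  have "continuous_map ?XX euclideanreal (h \<circ> fst)" "continuous_map ?XX euclideanreal (h \<circ> snd)"
    using h by (auto intro: continuous_map_compose continuous_map_fst continuous_map_snd)
  then have d: "continuous_map ?XX euclideanreal d"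
    unfolding d_def comp_def by (intro continuous_intros)
  then have "cozero_set ?XX S"
    unfolding cozero_set_def S_def by blast
  then have "Cstar_embedded ?XX S" by (rule XX)
  moreover have "continuous_map (subtopology ?XX S) euclideanreal (\<lambda>z. d z / \<bar>d z\<bar>)"
    using continuous_map_from_subtopology[OF d, of S]
    by (intro continuous_intros) (auto simp: S_def)
  moreover have "bounded ((\<lambda>z. d z / \<bar>d z\<bar>) ` S)"
    unfolding bounded_iff by (rule exI[of _ 1]) auto
  ultimately obtain g where g: "continuous_map ?XX euclideanreal g"
    and gS: "\<And>z. z \<in> S \<Longrightarrow> g z = d z / \<bar>d z\<bar>"
    unfolding Cstar_embedded_def by blast
  have "closedin X N"
  proof (rule ccontr)
    assume "\<not> closedin X N"
    moreover have "N \<subseteq> topspace X" by (auto simp: N_def)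
    ultimately obtain p where p: "p \<in> X closure_of N" "p \<notin> N"
      using closure_of_subset_eq by blast
    have pX: "p \<in> topspace X" using p(1) by (meson in_closure_of)
    have hp: "h p = 0" using p(2) pX by (simp add: N_def)
    have pairs: "continuous_map X ?XX (\<lambda>x. (p, x))" "continuous_map X ?XX (\<lambda>x. (x, p))"
      using pX by (simp_all add: continuous_map_pairedI)
    have c1: "continuous_map X euclideanreal (\<lambda>x. g (p, x))"
      and c2: "continuous_map X euclideanreal (\<lambda>x. g (x, p))"
      using continuous_map_compose[OF pairs(1) g] continuous_map_compose[OF pairs(2) g]
      by (simp_all add: comp_def)
    have "g (p, p) = 1"
      by (rule forall_in_closure_of_eq[OF p(1) _ c1, of "\<lambda>_. 1"])
        (use pX hp in \<open>auto simp: gS N_def S_def d_def\<close>)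
    moreover have "g (p, p) = - 1"
      by (rule forall_in_closure_of_eq[OF p(1) _ c2, of "\<lambda>_. - 1"])
        (use pX hp in \<open>auto simp: gS N_def S_def d_def\<close>)
    ultimately show False by simp
  qed
  moreover have "{x \<in> topspace X. h x = 0} = topspace X - N"
    by (auto simp: N_def)
  ultimately show ?thesis by (simp add: openin_diff)
qed

section \<open>The square as a retract of the function space\<close>

lemma continuous_map_evaluation:
  assumes a: "a \<in> topspace X"
  shows "continuous_map (compact_open_topology X Y) Y (\<lambda>f. f a)"
  unfolding continuous_map
proof (intro conjI allI impI)
  show "(\<lambda>f. f a) ` topspace (compact_open_topology X Y) \<subseteq> topspace Y"
    using a by (auto simp: continuous_functions_def continuous_map_def)
  fix U assume "openin Y U"
  then have "openin (compact_open_topology X Y) {f \<in> continuous_functions X Y. f ` {a} \<subseteq> U}"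
    unfolding compact_open_topology_def using a
    by (intro topology_generated_by_Basis) (auto intro!: exI[of _ "{a}"] exI[of _ U])
  then show "openin (compact_open_topology X Y)
      {f \<in> topspace (compact_open_topology X Y). f a \<in> U}"
    by simp
qed

definition two_valued :: "'a topology \<Rightarrow> 'a set \<Rightarrow> 'b \<times> 'b \<Rightarrow> 'a \<Rightarrow> 'b" where
  "two_valued X A = (\<lambda>(x, y). restrict (\<lambda>t. if t \<in> A then x else y) (topspace X))"

lemma two_valued_in_continuous_functions:
  assumes A: "openin X A" "closedin X A" and xy: "x \<in> topspace Y" "y \<in> topspace Y"
  shows "two_valued X A (x, y) \<in> continuous_functions X Y"
proof -
  have "openin X {t \<in> topspace X. two_valued X A (x, y) t \<in> U}" for U
  proof -
    have "{t \<in> topspace X. two_valued X A (x, y) t \<in> U} =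
        (if x \<in> U then A else {}) \<union> (if y \<in> U then topspace X - A else {})"
      using openin_subset[OF A(1)] by (auto simp: two_valued_def)
    then show ?thesis using A by auto
  qed
  then show ?thesis
    using xy by (auto simp: continuous_functions_def continuous_map_def two_valued_def)
qed

text \<open>A function with values \<open>x\<close> on \<open>A\<close> and \<open>y\<close> off \<open>A\<close> maps \<open>C\<close> into \<open>U\<close> unless \<open>C\<close> meets
  a piece whose value is outside \<open>U\<close>; so the preimage of a subbasic set is a rectangle whose sides
  are \<open>U\<close> or the whole space.\<close>

lemma continuous_map_two_valued:
  assumes A: "openin X A" "closedin X A"
  shows "continuous_map (prod_topology Y Y) (compact_open_topology X Y) (two_valued X A)"
  unfolding compact_open_topology_def
proof (rule continuous_on_generated_topo)
  let ?B = "{{f \<in> continuous_functions X Y. f ` C \<subseteq> U} | C U. compactin X C \<and> openin Y U}"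
  have vals: "two_valued X A (x, y) \<in> continuous_functions X Y"
    if "x \<in> topspace Y" "y \<in> topspace Y" for x y
    using two_valued_in_continuous_functions[OF A that] .
  have "\<Union> ?B = continuous_functions X Y"
    using topspace_compact_open_topology[of X Y]
    unfolding compact_open_topology_def topology_generated_by_topspace .
  moreover have "two_valued X A ` topspace (prod_topology Y Y) \<subseteq> continuous_functions X Y"
    using vals by auto
  ultimately show "two_valued X A ` topspace (prod_topology Y Y) \<subseteq> \<Union> ?B"
    by (rule ssubst)
  fix W assume "W \<in> ?B"
  then obtain C U where W: "W = {f \<in> continuous_functions X Y. f ` C \<subseteq> U}"
    and C: "compactin X C" and U: "openin Y U"
    by blast
  have CX: "C \<subseteq> topspace X" by (rule compactin_subset_topspace[OF C])
  have image: "two_valued X A (x, y) ` C \<subseteq> U \<longleftrightarrow> (C \<inter> A = {} \<or> x \<in> U) \<and> (C \<subseteq> A \<or> y \<in> U)" for x y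
  proof -
    have "two_valued X A (x, y) ` (C \<inter> A) = (\<lambda>t. x) ` (C \<inter> A)"
      and "two_valued X A (x, y) ` (C - A) = (\<lambda>t. y) ` (C - A)"
      using CX by (auto simp: two_valued_def intro!: image_cong)
    moreover have "two_valued X A (x, y) ` C =
        two_valued X A (x, y) ` (C \<inter> A) \<union> two_valued X A (x, y) ` (C - A)"
      by (simp only: image_Un[symmetric] Int_Diff_Un)
    ultimately show ?thesis by (simp only: Un_subset_iff) blast
  qed
  have "two_valued X A -` W \<inter> topspace (prod_topology Y Y) =
      (if C \<inter> A = {} then topspace Y else U) \<times> (if C \<subseteq> A then topspace Y else U)"
  proof (intro set_eqI)
    fix z :: "'b \<times> 'b"
    obtain x y where "z = (x, y)" by (cases z)
    then show "z \<in> two_valued X A -` W \<inter> topspace (prod_topology Y Y) \<longleftrightarrow>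
        z \<in> (if C \<inter> A = {} then topspace Y else U) \<times> (if C \<subseteq> A then topspace Y else U)"
      using openin_subset[OF U] vals[of x y] by (auto simp: W image)
  qed
  then show "openin (prod_topology Y Y) (two_valued X A -` W \<inter> topspace (prod_topology Y Y))"
    using U by (simp add: openin_prod_Times_iff)
qed

lemma square_retract_of_function_space:
  assumes A: "openin X A" "closedin X A" and a: "a \<in> A" and b: "b \<in> topspace X - A"
  shows "retraction_maps (compact_open_topology X Y) (prod_topology Y Y)
           (\<lambda>f. (f a, f b)) (two_valued X A)"
proof -
  have "a \<in> topspace X" using a openin_subset[OF A(1)] by blast
  then show ?thesis
    using a b continuous_map_two_valued[OF A]
    by (auto simp: retraction_maps_def two_valued_def
        intro!: continuous_map_pairedI continuous_map_evaluation)
qed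

section \<open>A zero-set that is not open\<close>

text \<open>The witness is \<open>1 / (n + 1)\<close> for the first \<open>n\<close> with \<open>x \<notin> W n\<close>. Its strict upper level
  sets are unions of complements, and its strict lower level sets are finite intersections,
  of the \<open>W n\<close>.\<close>

lemma clopen_INT_zero_set:
  fixes W :: "nat \<Rightarrow> 'a set"
  assumes W: "\<And>n. openin X (W n)" "\<And>n. closedin X (W n)"
  obtains h :: "'a \<Rightarrow> real" where "continuous_map X euclideanreal h"
    "{x \<in> topspace X. h x = 0} = (\<Inter>n. W n)"
proof -
  define h where "h x = (if \<forall>n. x \<in> W n then 0 else inverse (real (Suc (LEAST n. x \<notin> W n))))" for x
  have first: "x \<notin> W (LEAST n. x \<notin> W n)" "(LEAST n. x \<notin> W n) \<le> n" if "x \<notin> W n" for x n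
    using LeastI[of "\<lambda>n. x \<notin> W n" n] Least_le[of "\<lambda>n. x \<notin> W n" n] that by simp_all
  have attained: "\<exists>n. x \<notin> W n \<and> h x = inverse (real (Suc n))" if "x \<notin> W m" for x m
    using first(1)[OF that] that by (auto simp: h_def)
  have ge: "inverse (real (Suc n)) \<le> h x" if "x \<notin> W n" for x n
    using first(2)[OF that] that by (auto simp: h_def intro!: le_imp_inverse_le)
  have above: "a < h x \<longleftrightarrow> a < 0 \<or> (\<exists>n. x \<notin> W n \<and> a < inverse (real (Suc n)))" for a x
  proof (cases "\<forall>n. x \<in> W n")
    case False
    then obtain n where n: "x \<notin> W n" "h x = inverse (real (Suc n))"
      using attained by blast
    then have "0 < h x" by simp
    then show ?thesis using n ge[of x] by (metis order.strict_trans order.strict_trans2)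
  qed (simp add: h_def)
  have below: "h x < a \<longleftrightarrow> 0 < a \<and> (\<forall>n. a \<le> inverse (real (Suc n)) \<longrightarrow> x \<in> W n)" for a x
  proof (cases "\<forall>n. x \<in> W n")
    case False
    then obtain n where n: "x \<notin> W n" "h x = inverse (real (Suc n))"
      using attained by blast
    then have "0 < h x" by simp
    then show ?thesis using n ge[of x] by (metis order.strict_trans not_le order.trans)
  qed (simp add: h_def)
  have "openin X {x \<in> topspace X. a < h x}" for a
  proof -
    have "{x \<in> topspace X. a < h x} = (if a < 0 then topspace X else
        \<Union> ((\<lambda>n. topspace X - W n) ` {n. a < inverse (real (Suc n))}))"
      unfolding above by auto
    moreover have "openin X (\<Union> ((\<lambda>n. topspace X - W n) ` {n. a < inverse (real (Suc n))}))"
      by (rule openin_Union) (use W(2) in auto)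
    ultimately show ?thesis by simp
  qed
  moreover have "openin X {x \<in> topspace X. h x < a}" for a
  proof (cases "0 < a")
    case True
    define F where "F = {n. a \<le> inverse (real (Suc n))}"
    have "F \<subseteq> {..nat \<lceil>inverse a\<rceil>}"
    proof
      fix n assume "n \<in> F"
      then have "real (Suc n) \<le> inverse a"
        using True le_imp_inverse_le[of a "inverse (real (Suc n))"] by (simp add: F_def)
      then show "n \<in> {..nat \<lceil>inverse a\<rceil>}" by simp linarith
    qed
    then have "finite F" by (rule finite_subset) simp
    moreover have "{x \<in> topspace X. h x < a} = topspace X \<inter> (\<Inter>n\<in>F. W n)"
      using True by (auto simp: below F_def)
    ultimately show ?thesis
      using W(1) by (cases "F = {}") (auto intro!: openin_Inter openin_Int)
  qed (simp add: below)
  ultimately have "continuous_map X euclideanreal h"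
    unfolding continuous_map_upper_lower_semicontinuous_lt by blast
  moreover have "{x \<in> topspace X. h x = 0} = (\<Inter>n. W n)"
    using openin_subset[OF W(1)] by (auto simp: h_def split: if_splits)
  ultimately show ?thesis by (rule that)
qed

lemma zero_dimensional_separation:
  assumes zd: "zero_dimensional_space X" and H: "Hausdorff_space X"
    and xy: "x \<in> topspace X" "y \<in> topspace X" "x \<noteq> y"
  obtains B where "openin X B" "closedin X B" "x \<in> B" "y \<notin> B"
proof -
  obtain U V where "openin X U" "x \<in> U" "y \<in> V" "disjnt U V"
    using H xy unfolding Hausdorff_space_def by meson
  then have U: "openin X U" "x \<in> U" "y \<notin> U"
    by (auto simp: disjnt_iff)
  obtain \<B> where clopen: "\<forall>B\<in>\<B>. openin X B \<and> closedin X B"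
    and base: "openin X = arbitrary union_of (\<lambda>B. B \<in> \<B>)"
    using zd by (auto simp: zero_dimensional_space_def)
  have "(arbitrary union_of (\<lambda>B. B \<in> \<B>)) U"
    using U(1) unfolding base .
  then obtain \<U> where \<U>: "\<U> \<subseteq> \<B>" "\<Union>\<U> = U"
    unfolding union_of_def by blast
  then obtain B where B: "B \<in> \<U>" "x \<in> B" using U(2) by blast
  then show ?thesis
    using \<U> U(3) clopen by (intro that[of B]) auto
qed

text \<open>A clopen set separating two points of \<open>W\<close> cuts \<open>W\<close> into two nonempty pieces, one of
  which is infinite.\<close>

lemma infinite_clopen_shrinks:
  assumes X: "zero_dimensional_space X" "Hausdorff_space X"
    and W: "openin X W" "closedin X W" "infinite W"
  shows "\<exists>V. (openin X V \<and> closedin X V \<and> infinite V) \<and> V \<subset> W"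
proof -
  obtain x where x: "x \<in> W" using W(3) by fastforce
  obtain y where y: "y \<in> W" "y \<noteq> x"
    using infinite_imp_nonempty[OF infinite_remove[OF W(3), of x]] by blast
  obtain B where B: "openin X B" "closedin X B" "x \<in> B" "y \<notin> B"
    using zero_dimensional_separation[OF X] x y openin_subset[OF W(1)] by (metis subsetD)
  have "W = (W \<inter> B) \<union> (W - B)" by blast
  then consider "infinite (W \<inter> B)" | "infinite (W - B)"
    using W(3) by (metis finite_Un)
  then show ?thesis
  proof cases
    case 1
    then show ?thesis using W B y by (intro exI[of _ "W \<inter> B"]) auto
  next
    case 2
    then show ?thesis using W B x by (intro exI[of _ "W - B"]) (auto intro: openin_diff closedin_diff)
  qed
qed

text \<open>If the intersection were open, its complement would be compact and covered by the increasing
  complements of the \<open>W n\<close>, so the sequence would be eventually constant.\<close>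

lemma INT_strictly_decreasing_not_open:
  fixes W :: "nat \<Rightarrow> 'a set"
  assumes X: "compact_space X"
    and W: "\<And>n. closedin X (W n)" "\<And>n. W (Suc n) \<subset> W n"
  shows "\<not> openin X (\<Inter>n. W n)"
proof
  assume "openin X (\<Inter>n. W n)"
  then have "compactin X (topspace X - (\<Inter>n. W n))"
    using X by (simp add: closedin_compact_space closedin_diff)
  moreover have "\<forall>U \<in> range (\<lambda>n. topspace X - W n). openin X U"
    using W(1) by auto
  moreover have "topspace X - (\<Inter>n. W n) \<subseteq> \<Union> (range (\<lambda>n. topspace X - W n))"
    by auto
  ultimately obtain \<F> where "finite \<F>" "\<F> \<subseteq> range (\<lambda>n. topspace X - W n)"
    and cover: "topspace X - (\<Inter>n. W n) \<subseteq> \<Union> \<F>"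
    unfolding compactin_def by meson
  then obtain I where I: "finite I" "\<F> = (\<lambda>n. topspace X - W n) ` I"
    by (meson finite_subset_image)
  have anti: "W n \<subseteq> W m" if "m \<le> n" for m n
    using lift_Suc_antimono_le[of W, OF psubset_imp_subset[OF W(2)] that] .
  obtain N where N: "\<And>n. n \<in> I \<Longrightarrow> n \<le> N"
    using I(1) finite_nat_set_iff_bounded_le by auto
  have "W N \<subseteq> (\<Inter>n. W n)"
  proof
    fix x assume x: "x \<in> W N"
    then have "x \<notin> topspace X - W n" if "n \<in> I" for n
      using anti[OF N[OF that]] by blast
    then have "x \<notin> topspace X - (\<Inter>n. W n)"
      using cover by (auto simp: I(2))
    then show "x \<in> (\<Inter>n. W n)"
      using closedin_subset[OF W(1)[of N]] x by blast
  qed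
  then show False using W(2)[of N] by blast
qed

lemma exists_zero_set_not_open:
  assumes inf: "infinite (topspace X)" and zd: "zero_dimensional_space X"
    and X: "compact_space X" and H: "Hausdorff_space X"
  obtains h :: "'a \<Rightarrow> real" where "continuous_map X euclideanreal h"
    "\<not> openin X {x \<in> topspace X. h x = 0}"
proof -
  have "\<exists>W. \<forall>n::nat. (openin X (W n) \<and> closedin X (W n) \<and> infinite (W n)) \<and> W (Suc n) \<subset> W n"
  proof (rule dependent_nat_choice)
    show "\<exists>V. openin X V \<and> closedin X V \<and> infinite V"
      using inf by (intro exI[of _ "topspace X"]) simp
    show "\<exists>V'. (openin X V' \<and> closedin X V' \<and> infinite V') \<and> V' \<subset> V"
      if "openin X V \<and> closedin X V \<and> infinite V" for V and n :: nat
      using that by (intro infinite_clopen_shrinks[OF zd H]) simp_all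
  qed
  then obtain W :: "nat \<Rightarrow> 'a set"
    where W: "\<forall>n. (openin X (W n) \<and> closedin X (W n) \<and> infinite (W n)) \<and> W (Suc n) \<subset> W n" ..
  then have op: "openin X (W n)" and cl: "closedin X (W n)" and dec: "W (Suc n) \<subset> W n" for n
    by simp_all
  obtain h :: "'a \<Rightarrow> real" where h: "continuous_map X euclideanreal h"
    "{x \<in> topspace X. h x = 0} = (\<Inter>n. W n)"
    by (rule clopen_INT_zero_set[of X W, OF op cl])
  have "\<not> openin X {x \<in> topspace X. h x = 0}"
    unfolding h(2) by (rule INT_strictly_decreasing_not_open[of X W, OF X cl dec])
  with h(1) show ?thesis by (rule that)
qed

section \<open>The function space\<close>

theorem theorem7p8:
  fixes X :: "'a topology"
  assumes "infinite (topspace X)"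
    and "zero_dimensional_space X"
    and "compact_space X"
    and "Hausdorff_space X"
  shows "\<not> F_space (compact_open_topology X X)"
proof
  assume "F_space (compact_open_topology X X)"
  then have F: "\<And>S. cozero_set (compact_open_topology X X) S \<Longrightarrow>
      Cstar_embedded (compact_open_topology X X) S"
    by (simp add: F_space_def)
  obtain A where A: "openin X A" "closedin X A" "infinite A" "A \<subset> topspace X"
    using infinite_clopen_shrinks[of X "topspace X"] assms by auto
  obtain a where a: "a \<in> A" using A(3) by fastforce
  obtain b where b: "b \<in> topspace X - A" using A(4) by blast
  note retraction = square_retract_of_function_space[OF A(1,2) a b, of X]
  obtain h :: "'a \<Rightarrow> real" where "continuous_map X euclideanreal h"
    and "\<not> openin X {x \<in> topspace X. h x = 0}"
    by (rule exists_zero_set_not_open[OF assms])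
  then show False
    using square_Cstar_embedded_imp_zero_sets_open[OF Cstar_embedded_cozero_retraction[OF retraction F]]
    by blast
qed

end
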